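(* Let $\mathbf p=(p_1,\dots,p_r)$ and $\mathbf q=(q_1,\dots,q_r)$ be probability distributions on $\mathcal X=\{c_1,\dots,c_r\}$ with $p_j>0$ and $q_j>0$ for all $j\in D$. Let $\widehat{\mathbf p}_n$ and $\widehat{\mathbf q}_m$ be the empirical distributions of i.i.d. samples $X_1,\dots,X_n$ from $\mathbf p$ and $Y_1,\dots,Y_m$ from $\mathbf q$. Put $$A_{KL,1}^{(s)}(\mathbf p,\mathbf q)=\tfrac12\bigl(A_{KL,1}(\mathbf p,\mathbf q)+A_{KL,4}(\mathbf p,\mathbf q)\bigr),\qquad A_{KL,2}^{(s)}(\mathbf p,\mathbf q)=\tfrac12\bigl(A_{KL,2}(\mathbf p,\mathbf q)+A_{KL,3}(\mathbf p,\mathbf q)\bigr).$$ Then: (a) (One sample) $$\limsup_{n\to+\infty}\frac{|\mathcal D_{KL}^{(s)}(\widehat{\mathbf p}_n,\mathbf q)-\mathcal D_{KL}^{(s)}(\mathbf p,\mathbf q)|}{a_n}\le A_{KL,1}^{(s)}(\mathbf p,\mathbf q)\quad\text{a.s.},\qquad\limsup_{n\to+\infty}\frac{|\mathcal D_{KL}^{(s)}(\mathbf p,\widehat{\mathbf q}_n)-\mathcal D_{KL}^{(s)}(\mathbf p,\mathbf q)|}{b_n}\le A_{KL,2}^{(s)}(\mathbf p,\mathbf q)\quad\text{a.s.}$$ (b) (Two samples) $$\limsup_{(n,m)\to(+\infty,+\infty)}\frac{|\mathcal D_{KL}^{(s)}(\widehat{\mathbf p}_n,\widehat{\mathbf q}_m)-\mathcal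 D_{KL}^{(s)}(\mathbf p,\mathbf q)|}{c_{n,m}}\le A_{KL,1}^{(s)}(\mathbf p,\mathbf q)+A_{KL,2}^{(s)}(\mathbf p,\mathbf q)\quad\text{a.s.}$$
   Context: $\mathcal X=\{c_1,\dots,c_r\}$ with $r\ge 2$ is a finite set of distinct points and $D=\{1,\dots,r\}$. A probability distribution $\mathbf p$ on $\mathcal X$ is identified with the vector $(p_1,\dots,p_r)$, $p_j$ being the mass of $c_j$. $X_1,X_2,\dots$ are i.i.d. with $\mathbb P(X_i=c_j)=p_j$, and $Y_1,Y_2,\dots$ are i.i.d. with $\mathbb P(Y_i=c_j)=q_j$; the two sequences are independent of each other. Empirical probabilities: $\widehat p_n^{c_j}=\frac1n\sum_{i=1}^n 1_{\{X_i=c_j\}}$, $\widehat q_m^{c_j}=\frac1m\sum_{i=1}^m 1_{\{Y_i=c_j\}}$, $\widehat{\mathbf p}_n=(\widehat p_n^{c_j})_{j\in D}$, $\widehat{\mathbf q}_m=(\widehat q_m^{c_j})_{j\in D}$. $a_n=\sup_{j\in D}|\widehat p_n^{c_j}-p_j|$, $b_m=\sup_{j\in D}|\widehat q_m^{c_j}-q_j|$, $c_{n,m}=\max(a_n,b_m)$. Kullback-Leibler divergence: $\mathcal D_{KL}(\mathbf p,\mathbf q)=\sum_{j\in D}p_j\log(p_j/q_j)$ (natural logarithm); symmetrized form: $\mathcal D_{KL}^{(s)}(\mathbf p,\mathbf q)=\frac12\bigl(\mathcal D_{KL}(\mathbf p,\mathbf q)+\mathcal D_{KL}(\mathbf q,\mathbf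 p)\bigr)$. $$A_{KL,1}(\mathbf p,\mathbf q)=\sum_{j\in D}|1+\log(p_j/q_j)|,\quad A_{KL,2}(\mathbf p,\mathbf q)=\sum_{j\in D}p_j/q_j,$$ $$A_{KL,3}(\mathbf p,\mathbf q)=\sum_{j\in D}|1+\log(q_j/p_j)|,\quad A_{KL,4}(\mathbf p,\mathbf q)=\sum_{j\in D}q_j/p_j.$$ Conventions: a ratio $0/0$ of a difference by $a_n$, $b_n$ or $c_{n,m}$ is read as $0$; if an empirical divergence is undefined because some empirical probability vanishes, it is given the value $0$; $\limsup_{(n,m)\to(+\infty,+\infty)}x_{n,m}=\lim_{N\to\infty}\sup_{n,m\ge N}x_{n,m}$. *)

theory Defs
  imports "HOL-Probability.Probability"
begin

text \<open>
  Points are c j for j in {1..r}, samples are indexed from 1, and a distribution on the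
  points is the vector of its masses, a function of type nat => real used on {1..r} only.
\<close>

definition emp_prob :: "(nat \<Rightarrow> 'a) \<Rightarrow> (nat \<Rightarrow> 'w \<Rightarrow> 'a) \<Rightarrow> nat \<Rightarrow> 'w \<Rightarrow> nat \<Rightarrow> real" where
  "emp_prob c X n \<omega> j = (1 / real n) * (\<Sum>i=1..n. of_bool (X i \<omega> = c j))"

text \<open>
  Deviations are used as denominators, with x / 0 = 0. For sample sizes at least 1, a zero
  deviation makes the corresponding numerator zero too, so only 0 / 0 is concerned.
\<close>

definition sup_dev :: "nat \<Rightarrow> (nat \<Rightarrow> real) \<Rightarrow> (nat \<Rightarrow> real) \<Rightarrow> real" where
  "sup_dev r u v = (SUP j\<in>{1..r}. \<bar>u j - v j\<bar>)"

text \<open>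
  The divergence is set to 0 as soon as one of the masses vanishes; in the uses below this
  can only be an empirical mass. Since the condition is symmetric in the two arguments, the
  symmetrized divergence is then 0 as well.
\<close>

definition KL_div :: "nat \<Rightarrow> (nat \<Rightarrow> real) \<Rightarrow> (nat \<Rightarrow> real) \<Rightarrow> real" where
  "KL_div r p q =
     (if \<exists>j\<in>{1..r}. p j = 0 \<or> q j = 0 then 0 else (\<Sum>j=1..r. p j * ln (p j / q j)))"

definition KL_div_sym :: "nat \<Rightarrow> (nat \<Rightarrow> real) \<Rightarrow> (nat \<Rightarrow> real) \<Rightarrow> real" where
  "KL_div_sym r p q = (1 / 2) * (KL_div r p q + KL_div r q p)"

definition A_KL1 :: "nat \<Rightarrow> (nat \<Rightarrow> real) \<Rightarrow> (nat \<Rightarrow> real) \<Rightarrow> real" where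
  "A_KL1 r p q = (\<Sum>j=1..r. \<bar>1 + ln (p j / q j)\<bar>)"

definition A_KL2 :: "nat \<Rightarrow> (nat \<Rightarrow> real) \<Rightarrow> (nat \<Rightarrow> real) \<Rightarrow> real" where
  "A_KL2 r p q = (\<Sum>j=1..r. p j / q j)"

definition A_KL3 :: "nat \<Rightarrow> (nat \<Rightarrow> real) \<Rightarrow> (nat \<Rightarrow> real) \<Rightarrow> real" where
  "A_KL3 r p q = (\<Sum>j=1..r. \<bar>1 + ln (q j / p j)\<bar>)"

definition A_KL4 :: "nat \<Rightarrow> (nat \<Rightarrow> real) \<Rightarrow> (nat \<Rightarrow> real) \<Rightarrow> real" where
  "A_KL4 r p q = (\<Sum>j=1..r. q j / p j)"

definition A_KL1_sym :: "nat \<Rightarrow> (nat \<Rightarrow> real) \<Rightarrow> (nat \<Rightarrow> real) \<Rightarrow> real" where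
  "A_KL1_sym r p q = (1 / 2) * (A_KL1 r p q + A_KL4 r p q)"

definition A_KL2_sym :: "nat \<Rightarrow> (nat \<Rightarrow> real) \<Rightarrow> (nat \<Rightarrow> real) \<Rightarrow> real" where
  "A_KL2_sym r p q = (1 / 2) * (A_KL2 r p q + A_KL3 r p q)"

definition limsup2 :: "(nat \<Rightarrow> nat \<Rightarrow> ereal) \<Rightarrow> ereal" where
  "limsup2 x = lim (\<lambda>N. SUP (n, m)\<in>{N..} \<times> {N..}. x n m)"

lemma limsup2_tendsto:
  "(\<lambda>N. SUP (n, m)\<in>{N..} \<times> {N..}. x n m) \<longlonglongrightarrow> (INF N. SUP (n, m)\<in>{N..} \<times> {N..}. x n m)"
  for x :: "nat \<Rightarrow> nat \<Rightarrow> ereal"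
proof (rule LIMSEQ_INF)
  show "decseq (\<lambda>N. SUP (n, m)\<in>{N..} \<times> {N..}. x n m)"
    unfolding decseq_def by (intro allI impI) (rule SUP_subset_mono; auto)
qed

lemma limsup2_eq_Limsup:
  "limsup2 x = Limsup (sequentially \<times>\<^sub>F sequentially) (\<lambda>(n, m). x n m)"
proof -
  have "limsup2 x = (INF N. SUP (n, m)\<in>{N..} \<times> {N..}. x n m)"
    unfolding limsup2_def by (rule limI[OF limsup2_tendsto])
  also have "\<dots> = (INF P\<in>{P. eventually P (sequentially \<times>\<^sub>F sequentially)}.
      SUP z\<in>{z. P z}. (\<lambda>(n, m). x n m) z)"
  proof (rule antisym)
    show "(INF N. SUP (n, m)\<in>{N..} \<times> {N..}. x n m)
      \<le> (INF P\<in>{P. eventually P (sequentially \<times>\<^sub>F sequentially)}. SUP z\<in>{z. P z}. (\<lambda>(n, m). x n m) z)"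
    proof (rule INF_greatest)
      fix P :: "nat \<times> nat \<Rightarrow> bool"
      assume "P \<in> {P. eventually P (sequentially \<times>\<^sub>F sequentially)}"
      then obtain N where "\<forall>m\<ge>N. \<forall>n\<ge>N. P (n, m)"
        by (auto simp: eventually_prod_sequentially)
      then have sub: "{N..} \<times> {N..} \<subseteq> {z. P z}" by auto
      show "(INF N. SUP (n, m)\<in>{N..} \<times> {N..}. x n m) \<le> (SUP z\<in>{z. P z}. (\<lambda>(n, m). x n m) z)"
        by (rule INF_lower2[where i = N]) (use sub in \<open>auto intro!: SUP_subset_mono\<close>)
    qed
  next
    show "(INF P\<in>{P. eventually P (sequentially \<times>\<^sub>F sequentially)}.
        SUP z\<in>{z. P z}. (\<lambda>(n, m). x n m) z) \<le> (INF N. SUP (n, m)\<in>{N..} \<times> {N..}. x n m)"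
    proof (rule INF_greatest)
      fix N :: nat
      have ev: "eventually (\<lambda>z. z \<in> {N..} \<times> {N..}) (sequentially \<times>\<^sub>F sequentially)"
        by (auto simp: eventually_prod_sequentially)
      show "(INF P\<in>{P. eventually P (sequentially \<times>\<^sub>F sequentially)}.
          SUP z\<in>{z. P z}. (\<lambda>(n, m). x n m) z) \<le> (SUP (n, m)\<in>{N..} \<times> {N..}. x n m)"
        by (rule INF_lower2[where i = "\<lambda>z. z \<in> {N..} \<times> {N..}"]) (use ev in \<open>simp_all\<close>)
    qed
  qed
  finally show ?thesis unfolding Limsup_def .
qed

end

(*
  By Hoeffding's inequality and the Borel-Cantelli lemma the empirical masses converge
  almost surely. The rest is deterministic: the symmetrized divergence is half a sum of terms
  g(u, v) = u ln (u/v) + v ln (v/u), which is differentiable at (a, b) with partial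
  derivatives 1 + ln (a/b) - b/a and 1 + ln (b/a) - a/b. Along any filter on which the masses
  converge, the increment of the divergence is therefore eventually at most
  (A1 + e) |u - p| + (A2 + e) |v - q| in the sup distance, where A1 and A2 are the
  symmetrized constants. The one-sample bounds are the case where
  one argument is constant.
*)
theory Submission imports Defs
begin

section \<open>Almost sure convergence of bounded averages and of empirical masses\<close>

text \<open>For fixed \<open>e\<close>, Hoeffding's inequality makes the probabilities of deviations
  of the sum by at least \<open>n * e\<close> decay geometrically in \<open>n\<close>. They are
  therefore summable, and by Borel-Cantelli almost surely only finitely many of these deviations
  occur.\<close>

lemma (in prob_space) indep_bounded_average_AE_tendsto:
  fixes Z :: "nat \<Rightarrow> 'a \<Rightarrow> real"
  assumes indep: "indep_vars (\<lambda>_. borel) Z {1..}"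
    and bounded: "\<And>i. i \<ge> 1 \<Longrightarrow> AE \<omega> in M. Z i \<omega> \<in> {a..b}"
    and expect: "\<And>i. i \<ge> 1 \<Longrightarrow> expectation (Z i) = \<mu>"
  shows "AE \<omega> in M. (\<lambda>n. (1 / real n) * (\<Sum>i=1..n. Z i \<omega>)) \<longlonglongrightarrow> \<mu>"
proof -
  have rv [measurable]: "Z i \<in> borel_measurable M" if "i \<ge> 1" for i
    using indep that unfolding indep_vars_def by auto
  define S where "S n \<omega> = (\<Sum>i=1..n. Z i \<omega>)" for n \<omega>
  have S_meas [measurable]: "S n \<in> borel_measurable M" for n
    unfolding S_def by (intro borel_measurable_sum rv) auto
  \<comment> \<open>Enlarging the interval makes its length positive, as Hoeffding's inequality requires.\<close>
  define L where "L = (max a b + 1 - a)\<^sup>2"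
  have L: "L > 0"
    unfolding L_def by (auto simp: max_def)
  have tail: "AE \<omega> in M. \<forall>\<^sub>F n in sequentially. \<bar>S n \<omega> - real n * \<mu>\<bar> < real n * e"
    if e: "e > 0" for e
  proof -
    \<comment> \<open>The event concerns sample size \<open>Suc n\<close>, so that the sum of
      squared interval lengths in Hoeffding's inequality is positive. The shift is undone at the end
      by \<open>eventually_sequentially_Suc\<close>.\<close>
    define A where "A n = {\<omega> \<in> space M. \<bar>S (Suc n) \<omega> - real (Suc n) * \<mu>\<bar> \<ge> real (Suc n) * e}" for n
    have bound: "prob (A n) \<le> 2 * exp (-2 * e\<^sup>2 / L) ^ Suc n" for n
    proof -
      interpret H: Hoeffding_ineq M "{1..Suc n}" Z "\<lambda>_. a" "\<lambda>_. max a b + 1" "real (Suc n) * \<mu>"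
      proof unfold_locales
        show "indep_vars (\<lambda>_. borel) Z {1..Suc n}"
          using indep by (rule indep_vars_subset) auto
        fix i assume i: "i \<in> {1..Suc n}"
        show "AE x in M. Z i x \<in> {a..max a b + 1}"
          by (rule eventually_mono[OF bounded]) (use i in auto)
      next
        show "real (Suc n) * \<mu> \<equiv> (\<Sum>i\<in>{1..Suc n}. expectation (Z i))"
          using expect by (intro eq_reflection) simp
      qed auto
      have "prob (A n) \<le> 2 * exp (-2 * (real (Suc n) * e)\<^sup>2 / (\<Sum>i\<in>{1..Suc n}. (max a b + 1 - a)\<^sup>2))"
        unfolding A_def S_def by (rule H.Hoeffding_ineq_abs_ge) (use e L in \<open>auto simp: L_def\<close>)
      \<comment> \<open>The squared sample size in the numerator meets one factor of it in the
        denominator. The exponent is thus linear in \<open>Suc n\<close>, and the bound is a term of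
        a geometric series.\<close>
      also have "-2 * (real (Suc n) * e)\<^sup>2 / (\<Sum>i\<in>{1..Suc n}. (max a b + 1 - a)\<^sup>2)
          = real (Suc n) * (-2 * e\<^sup>2 / L)"
        unfolding L_def[symmetric] using L
        by (simp add: field_simps power2_eq_square del: of_nat_Suc)
      also have "exp \<dots> = exp (-2 * e\<^sup>2 / L) ^ Suc n"
        by (rule exp_of_nat_mult)
      finally show ?thesis .
    qed
    have "summable (\<lambda>n. 2 * exp (-2 * e\<^sup>2 / L) ^ Suc n)"
      using e L by (intro summable_mult summable_Suc_iff[THEN iffD2] summable_geometric) auto
    then have "summable (\<lambda>n. prob (A n))"
      by (rule summable_comparison_test'[where N = 0]) (use bound in auto)
    moreover have "A n \<in> sets M" for n
      unfolding A_def by measurable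
    ultimately have "AE \<omega> in M. \<forall>\<^sub>F n in sequentially. \<omega> \<in> space M - A n"
      by (intro borel_cantelli_AE1) (auto simp: emeasure_eq_measure)
    then show ?thesis
    proof (rule eventually_mono)
      fix \<omega> assume "\<forall>\<^sub>F n in sequentially. \<omega> \<in> space M - A n"
      then have "\<forall>\<^sub>F n in sequentially. \<bar>S (Suc n) \<omega> - real (Suc n) * \<mu>\<bar> < real (Suc n) * e"
        by eventually_elim (auto simp: A_def)
      then show "\<forall>\<^sub>F n in sequentially. \<bar>S n \<omega> - real n * \<mu>\<bar> < real n * e"
        by (subst eventually_sequentially_Suc[symmetric])
    qed
  qed
  \<comment> \<open>The null set in \<open>tail\<close> depends on \<open>e\<close>. The countably
    many tolerances \<open>1 / Suc k\<close> suffice for convergence and share a single null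
    set.\<close>
  have "AE \<omega> in M. \<forall>k. \<forall>\<^sub>F n in sequentially. \<bar>S n \<omega> - real n * \<mu>\<bar> < real n * (1 / real (Suc k))"
    unfolding AE_all_countable by (intro allI tail) simp
  then show ?thesis
  proof (rule eventually_mono)
    fix \<omega> assume *: "\<forall>k. \<forall>\<^sub>F n in sequentially. \<bar>S n \<omega> - real n * \<mu>\<bar> < real n * (1 / real (Suc k))"
    show "(\<lambda>n. (1 / real n) * (\<Sum>i=1..n. Z i \<omega>)) \<longlonglongrightarrow> \<mu>"
    proof (rule tendstoI)
      fix e :: real assume "e > 0"
      then obtain k where k: "1 / real (Suc k) < e"
        using nat_approx_posE by blast
      show "\<forall>\<^sub>F n in sequentially. dist ((1 / real n) * (\<Sum>i=1..n. Z i \<omega>)) \<mu> < e"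
        using *[rule_format, of k] eventually_gt_at_top[of 0]
      proof eventually_elim
        case (elim n)
        have "dist ((1 / real n) * (\<Sum>i=1..n. Z i \<omega>)) \<mu> = \<bar>S n \<omega> - real n * \<mu>\<bar> / real n"
        proof -
          have "(1 / real n) * (\<Sum>i=1..n. Z i \<omega>) - \<mu> = (S n \<omega> - real n * \<mu>) / real n"
            using elim by (simp add: S_def field_simps)
          then show ?thesis by (simp add: dist_real_def)
        qed
        also have "\<dots> < 1 / real (Suc k)"
          using elim by (simp add: field_simps)
        finally show ?case using k by simp
      qed
    qed
  qed
qed

text \<open>An empirical mass is the average of the indicators of \<open>X i \<omega> = c j\<close>,
  which take values in \<open>{0..1}\<close> and have mean \<open>p j\<close>. As there are finitely
  many \<open>j\<close>, one null set serves all of them.\<close>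

lemma (in prob_space) emp_prob_AE_tendsto:
  assumes indep: "indep_vars (\<lambda>_. count_space C) X {1..}"
    and masses: "\<And>i j. i \<ge> 1 \<Longrightarrow> j \<in> {1..r} \<Longrightarrow> prob {\<omega> \<in> space M. X i \<omega> = c j} = p j"
  shows "AE \<omega> in M. \<forall>j\<in>{1..r}. (\<lambda>n. emp_prob c X n \<omega> j) \<longlonglongrightarrow> p j"
proof (rule AE_finite_allI)
  fix j assume j: "j \<in> {1..r}"
  let ?Z = "\<lambda>i \<omega>. of_bool (X i \<omega> = c j) :: real"
  \<comment> \<open>Every function on a discrete space is measurable, so the indicators inherit
    independence from \<open>X\<close>.\<close>
  have Z: "indep_vars (\<lambda>_. borel) ?Z {1..}"
    using indep by (rule indep_vars_compose2) simp
  have "expectation (?Z i) = p j" if i: "i \<ge> 1" for i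
  proof -
    have "expectation (?Z i) = expectation (indicator {\<omega> \<in> space M. X i \<omega> = c j})"
      by (intro Bochner_Integration.integral_cong) (auto simp: indicator_def)
    also have "\<dots> = prob {\<omega> \<in> space M. X i \<omega> = c j}"
      by (simp add: Int_absorb2)
    finally show ?thesis using masses[OF i j] by simp
  qed
  then show "AE \<omega> in M. (\<lambda>n. emp_prob c X n \<omega> j) \<longlonglongrightarrow> p j"
    unfolding emp_prob_def
    by (intro indep_bounded_average_AE_tendsto[OF Z, where a = 0 and b = 1]) auto
qed simp

section \<open>Sup deviations and the first-order expansion of the symmetrized divergence\<close>

lemma abs_diff_le_sup_dev:
  assumes "j \<in> {1..r}"
  shows "\<bar>u j - v j\<bar> \<le> sup_dev r u v"
  unfolding sup_dev_def using assms by (intro cSUP_upper) auto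

lemma sup_dev_nonneg:
  assumes "r \<ge> 1"
  shows "sup_dev r u v \<ge> 0"
  using abs_diff_le_sup_dev[of 1 r u v] assms by (meson abs_ge_zero atLeastAtMost_iff order.refl order_trans)

lemma sup_dev_self:
  assumes "r \<ge> 1"
  shows "sup_dev r u u = 0"
  unfolding sup_dev_def using assms by simp

text \<open>This is differentiability at \<open>(a, b)\<close> of one summand of the divergence,
  with \<open>e\<close> as the relative size of the remainder. The filter is arbitrary so that
  single and double sequences are covered at once.\<close>

lemma KL_sym_term_bound:
  fixes a b e :: real
  assumes a: "a > 0" and b: "b > 0" and e: "e > 0"
    and u: "(u \<longlongrightarrow> a) F" and v: "(v \<longlongrightarrow> b) F"
  shows "\<forall>\<^sub>F x in F.
    \<bar>(u x * ln (u x / v x) + v x * ln (v x / u x)) - (a * ln (a / b) + b * ln (b / a))\<bar>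
      \<le> (\<bar>1 + ln (a / b)\<bar> + b / a + e) * \<bar>u x - a\<bar>
        + (a / b + \<bar>1 + ln (b / a)\<bar> + e) * \<bar>v x - b\<bar>"
proof -
  define g where "g z = fst z * ln (fst z / snd z) + snd z * ln (snd z / fst z)" for z :: "real \<times> real"
  define D where "D h = (1 + ln (a / b) - b / a) * fst h + (1 + ln (b / a) - a / b) * snd h"
    for h :: "real \<times> real"
  have "(g has_derivative D) (at (a, b))"
    unfolding g_def D_def
    by (rule derivative_eq_intros refl | use a b in \<open>simp; fail\<close>)+
       (use a b in \<open>auto simp: field_simps\<close>)
  then obtain d where d: "d > 0"
    and g: "\<And>z. norm (z - (a, b)) < d \<Longrightarrow> norm (g z - g (a, b) - D (z - (a, b))) \<le> e * norm (z - (a, b))"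
    unfolding has_derivative_at_alt using e by blast
  have "((\<lambda>x. (u x, v x)) \<longlongrightarrow> (a, b)) F"
    using u v by (rule tendsto_Pair)
  then have "\<forall>\<^sub>F x in F. dist (u x, v x) (a, b) < d"
    using d by (rule tendstoD)
  then show ?thesis
  proof eventually_elim
    case (elim x)
    let ?h = "u x - a" and ?k = "v x - b"
    \<comment> \<open>The remainder is controlled by the Euclidean norm of the increment. Passing to
      the sum of absolute values adds the same \<open>e\<close> to each of the two
      coefficients.\<close>
    have norm_le: "norm (?h, ?k) \<le> \<bar>?h\<bar> + \<bar>?k\<bar>"
      using norm_Pair_le[of ?h ?k] by simp
    have "\<bar>g (u x, v x) - g (a, b) - D (?h, ?k)\<bar> \<le> e * norm (?h, ?k)"
      using g[of "(u x, v x)"] elim by (simp add: dist_norm)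
    also have "\<dots> \<le> e * (\<bar>?h\<bar> + \<bar>?k\<bar>)"
      using e norm_le by (intro mult_left_mono) auto
    finally have rem: "\<bar>g (u x, v x) - g (a, b) - D (?h, ?k)\<bar> \<le> e * (\<bar>?h\<bar> + \<bar>?k\<bar>)" .
    have "\<bar>D (?h, ?k)\<bar> \<le> \<bar>1 + ln (a / b) - b / a\<bar> * \<bar>?h\<bar> + \<bar>1 + ln (b / a) - a / b\<bar> * \<bar>?k\<bar>"
      unfolding D_def fst_conv snd_conv abs_mult[symmetric] by (rule abs_triangle_ineq)
    \<comment> \<open>Each partial derivative is split by the triangle inequality. The pieces are
      the summands of \<open>A_KL1\<close> and \<open>A_KL4\<close> in the first coordinate, and of
      \<open>A_KL2\<close> and \<open>A_KL3\<close> in the second.\<close>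
    also have "\<dots> \<le> (\<bar>1 + ln (a / b)\<bar> + b / a) * \<bar>?h\<bar> + (a / b + \<bar>1 + ln (b / a)\<bar>) * \<bar>?k\<bar>"
      using divide_pos_pos[OF a b] divide_pos_pos[OF b a]
      by (intro add_mono mult_right_mono) linarith+
    finally have "\<bar>g (u x, v x) - g (a, b)\<bar>
        \<le> (\<bar>1 + ln (a / b)\<bar> + b / a) * \<bar>?h\<bar> + (a / b + \<bar>1 + ln (b / a)\<bar>) * \<bar>?k\<bar> + e * (\<bar>?h\<bar> + \<bar>?k\<bar>)"
      using rem by linarith
    also have "\<dots> = (\<bar>1 + ln (a / b)\<bar> + b / a + e) * \<bar>?h\<bar> + (a / b + \<bar>1 + ln (b / a)\<bar> + e) * \<bar>?k\<bar>"
      by (simp add: algebra_simps)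
    finally show ?case
      by (simp add: g_def)
  qed
qed

text \<open>The bounds for the single terms are summed over the finitely many coordinates and
  halved, each coordinate deviation being at most the sup deviation.\<close>

lemma KL_div_sym_bound:
  fixes u v :: "'x \<Rightarrow> nat \<Rightarrow> real"
  assumes p: "\<And>j. j \<in> {1..r} \<Longrightarrow> p j > 0" and q: "\<And>j. j \<in> {1..r} \<Longrightarrow> q j > 0"
    and u: "\<And>j. j \<in> {1..r} \<Longrightarrow> ((\<lambda>x. u x j) \<longlongrightarrow> p j) F"
    and v: "\<And>j. j \<in> {1..r} \<Longrightarrow> ((\<lambda>x. v x j) \<longlongrightarrow> q j) F"
    and r: "r \<ge> 1" and e: "e > 0"
  shows "\<forall>\<^sub>F x in F. \<bar>KL_div_sym r (u x) (v x) - KL_div_sym r p q\<bar>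
    \<le> (A_KL1_sym r p q + e) * sup_dev r (u x) p + (A_KL2_sym r p q + e) * sup_dev r (v x) q"
proof -
  define t where "t a b = a * ln (a / b) + b * ln (b / a)" for a b :: real
  define \<alpha> where "\<alpha> j = \<bar>1 + ln (p j / q j)\<bar> + q j / p j" for j
  define \<beta> where "\<beta> j = p j / q j + \<bar>1 + ln (q j / p j)\<bar>" for j
  \<comment> \<open>The slack \<open>d\<close> is added in \<open>r\<close> coordinates and the sum
    is halved, which leaves exactly \<open>e\<close>.\<close>
  define d where "d = 2 * e / real r"
  have d: "d > 0" using e r by (simp add: d_def)
  have KL: "KL_div_sym r a b = (\<Sum>j=1..r. t (a j) (b j)) / 2"
    if "\<And>j. j \<in> {1..r} \<Longrightarrow> a j \<noteq> 0 \<and> b j \<noteq> 0" for a b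
    using that unfolding KL_div_sym_def KL_div_def t_def by (auto simp: sum.distrib)
  have terms: "\<forall>\<^sub>F x in F. \<forall>j\<in>{1..r}. \<bar>t (u x j) (v x j) - t (p j) (q j)\<bar>
      \<le> (\<alpha> j + d) * \<bar>u x j - p j\<bar> + (\<beta> j + d) * \<bar>v x j - q j\<bar>"
    unfolding t_def \<alpha>_def \<beta>_def
    by (intro eventually_ball_finite ballI KL_sym_term_bound p q u v d) auto
  \<comment> \<open>Since the limits are positive, eventually no mass vanishes. The default value 0
    of \<open>KL_div\<close> is then out of play and \<open>KL\<close> applies.\<close>
  have pos: "\<forall>\<^sub>F x in F. \<forall>j\<in>{1..r}. u x j > 0 \<and> v x j > 0"
    using u v p q by (intro eventually_ball_finite ballI eventually_conj order_tendstoD(1)) auto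
  have \<alpha>_sum: "(\<Sum>j=1..r. \<alpha> j + d) = 2 * (A_KL1_sym r p q + e)"
    using r by (simp add: \<alpha>_def A_KL1_sym_def A_KL1_def A_KL4_def sum.distrib d_def)
  have \<beta>_sum: "(\<Sum>j=1..r. \<beta> j + d) = 2 * (A_KL2_sym r p q + e)"
    using r by (simp add: \<beta>_def A_KL2_sym_def A_KL2_def A_KL3_def sum.distrib d_def)
  from terms pos show ?thesis
  proof eventually_elim
    case (elim x)
    let ?U = "sup_dev r (u x) p" and ?V = "sup_dev r (v x) q"
    have "KL_div_sym r (u x) (v x) - KL_div_sym r p q
        = (\<Sum>j=1..r. t (u x j) (v x j) - t (p j) (q j)) / 2"
      using elim(2) p q by (subst (1 2) KL) (force simp: sum_subtractf diff_divide_distrib)+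
    then have "\<bar>KL_div_sym r (u x) (v x) - KL_div_sym r p q\<bar>
        \<le> (\<Sum>j=1..r. \<bar>t (u x j) (v x j) - t (p j) (q j)\<bar>) / 2"
      by (simp only: abs_divide abs_numeral divide_right_mono sum_abs zero_le_numeral)
    also have "(\<Sum>j=1..r. \<bar>t (u x j) (v x j) - t (p j) (q j)\<bar>)
        \<le> (\<Sum>j=1..r. (\<alpha> j + d) * ?U + (\<beta> j + d) * ?V)"
    proof (rule sum_mono)
      fix j assume j: "j \<in> {1..r}"
      have "\<alpha> j + d \<ge> 0" "\<beta> j + d \<ge> 0"
        using p[OF j] q[OF j] d by (auto simp: \<alpha>_def \<beta>_def)
      then have "(\<alpha> j + d) * \<bar>u x j - p j\<bar> + (\<beta> j + d) * \<bar>v x j - q j\<bar>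
          \<le> (\<alpha> j + d) * ?U + (\<beta> j + d) * ?V"
        by (intro add_mono mult_left_mono abs_diff_le_sup_dev j)
      with elim(1) j show "\<bar>t (u x j) (v x j) - t (p j) (q j)\<bar> \<le> (\<alpha> j + d) * ?U + (\<beta> j + d) * ?V"
        by fastforce
    qed
    also have "\<dots> = 2 * (A_KL1_sym r p q + e) * ?U + 2 * (A_KL2_sym r p q + e) * ?V"
      unfolding \<alpha>_sum[symmetric] \<beta>_sum[symmetric] sum_distrib_right sum.distrib[symmetric] ..
    finally show ?case by (simp add: field_simps)
  qed
qed

section \<open>From eventual inequalities to upper limits of ratios\<close>

lemma A_KL_sym_nonneg:
  assumes "\<And>j. j \<in> {1..r} \<Longrightarrow> p j > 0" and "\<And>j. j \<in> {1..r} \<Longrightarrow> q j > 0"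
  shows "A_KL1_sym r p q \<ge> 0" and "A_KL2_sym r p q \<ge> 0"
  unfolding A_KL1_sym_def A_KL2_sym_def A_KL1_def A_KL2_def A_KL3_def A_KL4_def
  using assms by (auto intro!: mult_nonneg_nonneg add_nonneg_nonneg sum_nonneg divide_nonneg_nonneg
      intro: less_imp_le simp del: zero_le_mult_iff)

text \<open>Where \<open>g x\<close> is positive, dividing by it bounds the ratio by
  \<open>A + e\<close>. Where \<open>g x = 0\<close>, the ratio is 0 by the convention for division,
  and \<open>A \<ge> 0\<close> gives the bound.\<close>

lemma Limsup_ratio_le:
  fixes f g :: "'x \<Rightarrow> real"
  assumes A: "A \<ge> 0" and g: "\<And>x. g x \<ge> 0"
    and bound: "\<And>e. e > 0 \<Longrightarrow> \<forall>\<^sub>F x in F. f x \<le> (A + e) * g x"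
  shows "Limsup F (\<lambda>x. ereal (f x / g x)) \<le> ereal A"
proof (rule ereal_le_epsilon2)
  fix e :: real assume e: "e > 0"
  have "\<forall>\<^sub>F x in F. ereal (f x / g x) \<le> ereal (A + e)"
    using bound[OF e]
  proof eventually_elim
    case (elim x)
    then show ?case
      using A e g[of x] by (cases "g x = 0") (auto simp: field_simps)
  qed
  then show "Limsup F (\<lambda>x. ereal (f x / g x)) \<le> ereal A + ereal e"
    by (intro Limsup_bounded) simp
qed

section \<open>Almost sure bounds for one and two samples\<close>

theorem corollary11:
  fixes M :: "'w measure" and r :: nat and c :: "nat \<Rightarrow> 'a"
    and p q :: "nat \<Rightarrow> real" and X Y :: "nat \<Rightarrow> 'w \<Rightarrow> 'a"
  assumes "prob_space M"
    and "r \<ge> 2" and "inj_on c {1..r}"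
    and "\<And>j. j \<in> {1..r} \<Longrightarrow> p j > 0" and "(\<Sum>j=1..r. p j) = 1"
    and "\<And>j. j \<in> {1..r} \<Longrightarrow> q j > 0" and "(\<Sum>j=1..r. q j) = 1"
    and "prob_space.indep_vars M (\<lambda>_. count_space (c ` {1..r})) X {1..}"
    and "\<And>i j. i \<ge> 1 \<Longrightarrow> j \<in> {1..r} \<Longrightarrow> measure M {\<omega> \<in> space M. X i \<omega> = c j} = p j"
    and "prob_space.indep_vars M (\<lambda>_. count_space (c ` {1..r})) Y {1..}"
    and "\<And>i j. i \<ge> 1 \<Longrightarrow> j \<in> {1..r} \<Longrightarrow> measure M {\<omega> \<in> space M. Y i \<omega> = c j} = q j"
    and "prob_space.indep_var M
           (\<Pi>\<^sub>M i\<in>{1..}. count_space (c ` {1..r})) (\<lambda>\<omega>. \<lambda>i\<in>{1..}. X i \<omega>)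
           (\<Pi>\<^sub>M i\<in>{1..}. count_space (c ` {1..r})) (\<lambda>\<omega>. \<lambda>i\<in>{1..}. Y i \<omega>)"
  shows "(AE \<omega> in M.
            limsup (\<lambda>n. ereal (\<bar>KL_div_sym r (emp_prob c X n \<omega>) q - KL_div_sym r p q\<bar>
                               / sup_dev r (emp_prob c X n \<omega>) p))
            \<le> ereal (A_KL1_sym r p q))
       \<and> (AE \<omega> in M.
            limsup (\<lambda>n. ereal (\<bar>KL_div_sym r p (emp_prob c Y n \<omega>) - KL_div_sym r p q\<bar>
                               / sup_dev r (emp_prob c Y n \<omega>) q))
            \<le> ereal (A_KL2_sym r p q))
       \<and> (AE \<omega> in M.
            limsup2 (\<lambda>n m. ereal (\<bar>KL_div_sym r (emp_prob c X n \<omega>) (emp_prob c Y m \<omega>) - KL_div_sym r p q\<bar>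
                               / max (sup_dev r (emp_prob c X n \<omega>) p) (sup_dev r (emp_prob c Y m \<omega>) q)))
            \<le> ereal (A_KL1_sym r p q + A_KL2_sym r p q))"
proof -
  interpret prob_space M by fact
  note p = assms(4) and q = assms(6)
  have r: "r \<ge> 1" using assms(2) by simp
  note nonneg = A_KL_sym_nonneg[of r p q, OF p q] and dev = sup_dev_nonneg[OF r]
  have X: "AE \<omega> in M. \<forall>j\<in>{1..r}. (\<lambda>n. emp_prob c X n \<omega> j) \<longlonglongrightarrow> p j"
    using assms(8,9) by (rule emp_prob_AE_tendsto)
  have Y: "AE \<omega> in M. \<forall>j\<in>{1..r}. (\<lambda>n. emp_prob c Y n \<omega> j) \<longlonglongrightarrow> q j"
    using assms(10,11) by (rule emp_prob_AE_tendsto)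
  show ?thesis
  proof (intro conjI)
    show "AE \<omega> in M.
        limsup (\<lambda>n. ereal (\<bar>KL_div_sym r (emp_prob c X n \<omega>) q - KL_div_sym r p q\<bar>
                           / sup_dev r (emp_prob c X n \<omega>) p)) \<le> ereal (A_KL1_sym r p q)"
      using X
    proof eventually_elim
      case (elim \<omega>)
      show ?case
      proof (rule Limsup_ratio_le[OF nonneg(1) dev])
        fix e :: real assume "e > 0"
        \<comment> \<open>The second argument is constantly \<open>q\<close>, so its deviation is 0
          and the second term of the bound drops out. The next case does the same with the first
          argument constantly \<open>p\<close>.\<close>
        from KL_div_sym_bound[of r p q "\<lambda>n. emp_prob c X n \<omega>" sequentially "\<lambda>_. q",
            OF p q _ _ r this] elim
        show "\<forall>\<^sub>F n in sequentially. \<bar>KL_div_sym r (emp_prob c X n \<omega>) q - KL_div_sym r p q\<bar>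
            \<le> (A_KL1_sym r p q + e) * sup_dev r (emp_prob c X n \<omega>) p"
          by (simp add: sup_dev_self[OF r])
      qed
    qed
  next
    show "AE \<omega> in M.
        limsup (\<lambda>n. ereal (\<bar>KL_div_sym r p (emp_prob c Y n \<omega>) - KL_div_sym r p q\<bar>
                           / sup_dev r (emp_prob c Y n \<omega>) q)) \<le> ereal (A_KL2_sym r p q)"
      using Y
    proof eventually_elim
      case (elim \<omega>)
      show ?case
      proof (rule Limsup_ratio_le[OF nonneg(2) dev])
        fix e :: real assume "e > 0"
        from KL_div_sym_bound[of r p q "\<lambda>_. p" sequentially "\<lambda>n. emp_prob c Y n \<omega>",
            OF p q _ _ r this] elim
        show "\<forall>\<^sub>F n in sequentially. \<bar>KL_div_sym r p (emp_prob c Y n \<omega>) - KL_div_sym r p q\<bar>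
            \<le> (A_KL2_sym r p q + e) * sup_dev r (emp_prob c Y n \<omega>) q"
          by (simp add: sup_dev_self[OF r])
      qed
    qed
  next
    show "AE \<omega> in M.
        limsup2 (\<lambda>n m. ereal (\<bar>KL_div_sym r (emp_prob c X n \<omega>) (emp_prob c Y m \<omega>) - KL_div_sym r p q\<bar>
                           / max (sup_dev r (emp_prob c X n \<omega>) p) (sup_dev r (emp_prob c Y m \<omega>) q)))
        \<le> ereal (A_KL1_sym r p q + A_KL2_sym r p q)"
      using X Y
    proof eventually_elim
      case (elim \<omega>)
      let ?F = "sequentially \<times>\<^sub>F sequentially"
      let ?u = "\<lambda>z. emp_prob c X (fst z) \<omega>" and ?v = "\<lambda>z. emp_prob c Y (snd z) \<omega>"
      let ?g = "\<lambda>z. max (sup_dev r (?u z) p) (sup_dev r (?v z) q)"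
      \<comment> \<open>The projections tend to infinity along the product filter, so convergence of
        each sample carries over to pairs \<open>(n, m)\<close>.\<close>
      have u: "((\<lambda>z. ?u z j) \<longlongrightarrow> p j) ?F" and v: "((\<lambda>z. ?v z j) \<longlongrightarrow> q j) ?F" if "j \<in> {1..r}" for j
        using elim that
        by (auto intro: filterlim_compose[OF _ filterlim_fst] filterlim_compose[OF _ filterlim_snd])
      have "Limsup ?F (\<lambda>z. ereal (\<bar>KL_div_sym r (?u z) (?v z) - KL_div_sym r p q\<bar> / ?g z))
          \<le> ereal (A_KL1_sym r p q + A_KL2_sym r p q)"
      proof (rule Limsup_ratio_le)
        show "A_KL1_sym r p q + A_KL2_sym r p q \<ge> 0" using nonneg by simp
        show "?g z \<ge> 0" for z using dev by (simp add: le_max_iff_disj)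
        fix e :: real assume e: "e > 0"
        \<comment> \<open>Both deviations are about to be replaced by their maximum, which adds up
          the two coefficients. A slack of \<open>e / 2\<close> in each gives a total of
          \<open>e\<close>.\<close>
        have "\<forall>\<^sub>F z in ?F. \<bar>KL_div_sym r (?u z) (?v z) - KL_div_sym r p q\<bar>
            \<le> (A_KL1_sym r p q + e / 2) * sup_dev r (?u z) p + (A_KL2_sym r p q + e / 2) * sup_dev r (?v z) q"
          by (rule KL_div_sym_bound[OF p q u v r]) (use e in auto)
        then show "\<forall>\<^sub>F z in ?F. \<bar>KL_div_sym r (?u z) (?v z) - KL_div_sym r p q\<bar>
            \<le> (A_KL1_sym r p q + A_KL2_sym r p q + e) * ?g z"
        proof eventually_elim
          case (elim z)
          also have "(A_KL1_sym r p q + e / 2) * sup_dev r (?u z) p + (A_KL2_sym r p q + e / 2) * sup_dev r (?v z) q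
              \<le> (A_KL1_sym r p q + e / 2) * ?g z + (A_KL2_sym r p q + e / 2) * ?g z"
            using nonneg e by (intro add_mono mult_left_mono) auto
          also have "\<dots> = (A_KL1_sym r p q + A_KL2_sym r p q + e) * ?g z"
            by (simp add: distrib_right[symmetric])
          finally show ?case .
        qed
      qed
      \<comment> \<open>The double upper limit is the \<open>Limsup\<close> along the product
        filter, because the quadrants \<open>{N..} \<times> {N..}\<close> form a base of that
        filter.\<close>
      then show ?case
        unfolding limsup2_eq_Limsup by (simp add: case_prod_unfold)
    qed
  qed
qed

end
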